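(* Let $p_0=x_0/y_0$ and $p_1=x_1/y_1$ be two distinct plants given by coprime factorizations with $x_i,y_i\in\mathbb{H}$ and $y_i$ proper but not strictly proper ($i=0,1$). For $\lambda\in[0,1]$ put $$x_\lambda=\lambda x_1+(1-\lambda)x_0,\qquad y_\lambda=\lambda y_1+(1-\lambda)y_0,\qquad p_\lambda=\frac{x_\lambda}{y_\lambda}.$$ Then there is a (single) proper compensator stabilizing all the plants $p_\lambda$, $\lambda\in[0,1]$, if and only if there exist $\delta_0,\delta_1\in\mathbb{J}$ satisfying all of the following conditions: (i) If $x_0y_1-x_1y_0$ has zeros at $s_1,\dots,s_t$ in $\mathbb{C}_+$ with multiplicities $m_1,\dots,m_t$ respectively, then $s_1,\dots,s_t$ are also zeros of $\delta_0y_1-\delta_1y_0$ and of $\delta_1x_0-\delta_0x_1$, with multiplicities not less than $m_1,\dots,m_t$ respectively. (ii) If $x_0y_1-x_1y_0=0$ at $\infty$ with multiplicity $m_\infty$, then $\delta_1x_0-\delta_0x_1=0$ at $\infty$ with the same multiplicity $m_\infty$. (iii) $\delta_1/\delta_0$ does not intersect the nonpositive real axis, including $\infty$, at any point of $\mathbb{C}_+$; that is, $(\delta_1/\delta_0)(s)\notin(-\infty,0]\cup\{\infty\}$ for every $s\in\mathbb{C}_+$.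
   Context: $\mathbb{C}_-$ is the open left half of the complex plane and $\mathbb{C}_+=(\mathbb{C}\setminus\mathbb{C}_-)\cup\{\infty\}$. $\mathbb{H}$ is the ring of proper rational functions in $s$ with real coefficients all of whose poles lie in $\mathbb{C}_-$, and $\mathbb{J}$ is the set of multiplicative units of $\mathbb{H}$. A proper rational function is not strictly proper if its value at $\infty$ is nonzero. Coprime means coprime in the ring $\mathbb{H}$. A proper compensator is a rational function $k=x_c/y_c$ with $x_c,y_c\in\mathbb{H}$ coprime and $y_c$ proper but not strictly proper. The compensator $k$ stabilizes the plant $p_\lambda=x_\lambda/y_\lambda$ if $x_\lambda x_c+y_\lambda y_c\in\mathbb{J}$ (i.e. the closed-loop denominator $x_\lambda x_c+y_\lambda y_c$ has all its zeros in $\mathbb{C}_-$ and is nonzero at $\infty$). *)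

theory Defs
  imports
    "HOL-Analysis.Analysis"
    "HOL-Computational_Algebra.Computational_Algebra"
    "HOL-Computational_Algebra.Field_as_Ring"
    "HOL-Library.Extended_Nat"
begin

type_synonym ratfun = "real poly fract"

datatype ecomplex = Fin complex | Infty

definition C_minus :: "complex set" where
  "C_minus = {s. Re s < 0}"

definition C_plus :: "ecomplex set" where
  "C_plus = insert Infty (Fin ` (- C_minus))"

definition const_rf :: "real \<Rightarrow> ratfun" where
  "const_rf c = to_fract [:c:]"

text \<open>
  Numerator and denominator are those of the reduced fraction with monic denominator;
  for the zero function they are 0 and 1.
\<close>

definition num :: "ratfun \<Rightarrow> real poly" where
  "num f = fst (quot_of_fract f)"

definition den :: "ratfun \<Rightarrow> real poly" where
  "den f = snd (quot_of_fract f)"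

abbreviation cpoly :: "real poly \<Rightarrow> complex poly" where
  "cpoly \<equiv> map_poly complex_of_real"

text \<open>
  At infinity, if the degree of the numerator does not exceed that of the denominator, the
  value is the coefficient of the numerator at the degree of the denominator, because the
  denominator is monic.
\<close>

fun rf_eval :: "ratfun \<Rightarrow> ecomplex \<Rightarrow> ecomplex" where
  "rf_eval f (Fin s) =
     (if poly (cpoly (den f)) s = 0 then Infty
      else Fin (poly (cpoly (num f)) s / poly (cpoly (den f)) s))"
| "rf_eval f Infty =
     (if degree (num f) > degree (den f) then Infty
      else Fin (of_real (coeff (num f) (degree (den f)))))"

definition proper :: "ratfun \<Rightarrow> bool" where
  "proper f \<longleftrightarrow> degree (num f) \<le> degree (den f)"

definition strictly_proper :: "ratfun \<Rightarrow> bool" where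
  "strictly_proper f \<longleftrightarrow> proper f \<and> rf_eval f Infty = Fin 0"

definition poles :: "ratfun \<Rightarrow> complex set" where
  "poles f = {s. poly (cpoly (den f)) s = 0}"

text \<open>
  The multiplicity of a point as a zero; it is 0 if the point is not a zero. The zero function
  vanishes everywhere with infinite multiplicity. In the clause for infinity the truncated
  subtraction gives 0 for functions that are not strictly proper.
\<close>

fun zero_mult :: "ratfun \<Rightarrow> ecomplex \<Rightarrow> enat" where
  "zero_mult f (Fin s) = (if f = 0 then \<infinity> else enat (order s (cpoly (num f))))"
| "zero_mult f Infty = (if f = 0 then \<infinity> else enat (degree (den f) - degree (num f)))"

definition HH :: "ratfun set" where
  "HH = {f. proper f \<and> poles f \<subseteq> C_minus}"

definition JJ :: "ratfun set" where
  "JJ = {u \<in> HH. \<exists>v\<in>HH. u * v = 1}"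

definition dvd_HH :: "ratfun \<Rightarrow> ratfun \<Rightarrow> bool" where
  "dvd_HH d a \<longleftrightarrow> (\<exists>q\<in>HH. a = d * q)"

definition coprime_HH :: "ratfun \<Rightarrow> ratfun \<Rightarrow> bool" where
  "coprime_HH a b \<longleftrightarrow> (\<forall>d\<in>HH. dvd_HH d a \<and> dvd_HH d b \<longrightarrow> d \<in> JJ)"

definition coprime_factorization :: "ratfun \<Rightarrow> ratfun \<Rightarrow> ratfun \<Rightarrow> bool" where
  "coprime_factorization p x y \<longleftrightarrow>
     x \<in> HH \<and> y \<in> HH \<and> coprime_HH x y \<and> \<not> strictly_proper y \<and> p = x / y"

definition proper_compensator :: "ratfun \<Rightarrow> bool" where
  "proper_compensator k \<longleftrightarrow> (\<exists>xc yc. coprime_factorization k xc yc)"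

text \<open>
  A plant enters through its numerator and denominator in \<open>HH\<close>, not only through their
  quotient: a factor common to \<open>x\<close> and \<open>y\<close> can destroy stabilization, and \<open>y\<close> may even be 0
  at an intermediate plant. The choice of the coprime factorization of \<open>k\<close>
  is immaterial, since two of them differ by a unit of \<open>HH\<close>.
\<close>

definition stabilizes :: "ratfun \<Rightarrow> ratfun \<Rightarrow> ratfun \<Rightarrow> bool" where
  "stabilizes k x y \<longleftrightarrow>
     (\<exists>xc yc. coprime_factorization k xc yc \<and> x * xc + y * yc \<in> JJ)"

end

theory Submission
  imports Defs
begin

text \<open>
  Put \<open>\<Delta> = x0 * y1 - x1 * y0\<close>. By Cramer's rule, the pairs \<open>(xc, yc)\<close> correspond to the pairs
  \<open>d0 = x0 * xc + y0 * yc\<close>, \<open>d1 = x1 * xc + y1 * yc\<close> through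
  \<open>xc * \<Delta> = d0 * y1 - d1 * y0\<close> and \<open>yc * \<Delta> = d1 * x0 - d0 * x1\<close>; the divisibility by \<open>\<Delta>\<close> in \<open>HH\<close> is
  the multiplicity condition. The closed-loop denominator of the plant with parameter \<open>l\<close> is
  \<open>(1 - l) * d0 + l * d1\<close>, and this vanishes at a point for some \<open>l\<close> in \<open>[0, 1]\<close> exactly when
  \<open>d1 / d0\<close> is real and nonpositive or infinite there.
\<close>

section \<open>Real polynomials over the complex numbers and reduced fractions\<close>

lemma cpoly_add: "cpoly (p + q) = cpoly p + cpoly q"
  by (intro poly_eqI) (simp add: coeff_map_poly)

lemma cpoly_mult: "cpoly (p * q) = cpoly p * cpoly q"
  by (intro poly_eqI) (simp add: coeff_map_poly coeff_mult)

lemma cpoly_eq_0_iff [simp]: "cpoly p = 0 \<longleftrightarrow> p = 0"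
  by (auto simp: poly_eq_iff coeff_map_poly)

lemma degree_cpoly [simp]: "degree (cpoly p) = degree p"
  by (intro degree_map_poly) auto

text \<open>The bounds \<open>n\<close> and \<open>m\<close> may exceed the true degrees; then both
  sides vanish. This reads off values at infinity without separating strictly proper functions from
  the others.\<close>

lemma coeff_mult_top:
  fixes p q :: "'a::comm_semiring_0 poly"
  assumes "degree p \<le> n" "degree q \<le> m"
  shows "coeff (p * q) (n + m) = coeff p n * coeff q m"
proof (cases "degree p = n \<and> degree q = m")
  case True
  then show ?thesis using coeff_mult_degree_sum[of p q] by auto
next
  case False
  then have "degree p < n \<or> degree q < m" using assms by auto
  moreover have "degree (p * q) < n + m"
    using calculation assms degree_mult_le[of p q] by linarith
  ultimately show ?thesis by (auto simp: coeff_eq_0)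
qed

lemma den_nonzero [simp]: "den f \<noteq> 0"
  by (simp add: den_def)

lemma num_eq_0_iff [simp]: "num f = 0 \<longleftrightarrow> f = 0"
  by (simp add: num_def)

lemma lead_coeff_den [simp]: "lead_coeff (den f) = 1"
proof -
  have "unit_factor (den f) = 1"
    by (simp add: den_def unit_factor_snd_quot_of_fract)
  then have "unit_factor (lead_coeff (den f)) = 1"
    by (simp add: unit_factor_poly_def one_pCons)
  \<comment> \<open>On the field \<open>real\<close>, \<open>unit_factor\<close> is the
    identity.\<close>
  then show ?thesis by (simp split: if_splits)
qed

lemma num_0 [simp]: "num 0 = 0"
  by simp

lemma num_div_den: "f = to_fract (num f) / to_fract (den f)"
  by (simp add: num_def den_def flip: Fract_conv_to_fract)

lemma mult_num_div_den: "f * g = to_fract (num f * num g) / to_fract (den f * den g)"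
  by (subst num_div_den[of f], subst num_div_den[of g]) (simp only: to_fract_mult times_divide_times_eq)

lemma divide_num_div_den: "f / g = to_fract (num f * den g) / to_fract (den f * num g)"
  by (subst num_div_den[of f], subst num_div_den[of g]) (simp only: to_fract_mult divide_divide_times_eq)

lemma add_num_div_den:
  "f + g = to_fract (num f * den g + num g * den f) / to_fract (den f * den g)"
  by (subst num_div_den[of f], subst num_div_den[of g]) (simp add: add_frac_eq)

text \<open>A Bezout identity between coprime real polynomials survives the passage to complex
  polynomials, where a common root would give 0 = 1.\<close>

lemma num_den_no_common_root:
  "poly (cpoly (num f)) s = 0 \<Longrightarrow> poly (cpoly (den f)) s \<noteq> 0"
proof
  assume zero: "poly (cpoly (num f)) s = 0" "poly (cpoly (den f)) s = 0"
  have "coprime (num f) (den f)"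
    by (simp add: num_def den_def coprime_quot_of_fract)
  then obtain u v where "u * num f + v * den f = 1"
    by (metis bezout_coefficients_fst_snd coprime_imp_gcd_eq_1)
  then have "cpoly u * cpoly (num f) + cpoly v * cpoly (den f) = 1"
    by (metis cpoly_add cpoly_mult map_poly_1' of_real_1)
  then have "poly (cpoly u * cpoly (num f) + cpoly v * cpoly (den f)) s = 1"
    by simp
  with zero show False by simp
qed

text \<open>Transfers facts between an unreduced quotient, as produced by arithmetic on fractions,
  and the reduced one on which the definitions are based.\<close>

lemma fract_cancel:
  assumes "f = to_fract a / to_fract b" "b \<noteq> 0"
  obtains c where "c \<noteq> 0" "a = num f * c" "b = den f * c"
proof -
  have "to_fract a / to_fract b = to_fract (num f) / to_fract (den f)"
    using assms(1) num_div_den[of f] by simp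
  then have "to_fract a * to_fract (den f) = to_fract (num f) * to_fract b"
    using assms(2) by (simp add: frac_eq_eq)
  then have eq: "a * den f = num f * b"
    by (simp flip: to_fract_mult)
  have "coprime (den f) (num f)"
    by (simp add: num_def den_def coprime_quot_of_fract coprime_commute)
  moreover have "den f dvd num f * b" by (simp flip: eq)
  ultimately have "den f dvd b" by (simp add: coprime_dvd_mult_right_iff)
  then obtain c where c: "b = den f * c" by blast
  with eq have "a = num f * c" by (simp add: mult_ac)
  with c assms(2) show thesis by (intro that[of c]) auto
qed

section \<open>Membership in \<open>HH\<close> and values on \<open>C_plus\<close>\<close>

lemma HH_D:
  assumes "f \<in> HH"
  shows "degree (num f) \<le> degree (den f)"
    and "Re s \<ge> 0 \<Longrightarrow> poly (cpoly (den f)) s \<noteq> 0"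
  using assms by (auto simp: HH_def proper_def poles_def C_minus_def)

text \<open>Cancelling a common factor preserves the difference of the degrees and can only remove
  roots of the denominator, so any representation may be used.\<close>

lemma HH_I:
  assumes f: "f = to_fract a / to_fract b" and "b \<noteq> 0" and deg: "degree a \<le> degree b"
    and nz: "\<And>s. Re s \<ge> 0 \<Longrightarrow> poly (cpoly b) s \<noteq> 0"
  shows "f \<in> HH"
proof -
  obtain c where c: "c \<noteq> 0" "a = num f * c" "b = den f * c"
    using fract_cancel f \<open>b \<noteq> 0\<close> by blast
  have "degree (num f) \<le> degree (den f)"
    using deg c by (cases "num f = 0") (auto simp: degree_mult_eq)
  moreover have "Re s < 0" if "poly (cpoly (den f)) s = 0" for s
    using nz[of s] that c by (auto simp: cpoly_mult not_less[symmetric])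
  ultimately show ?thesis by (auto simp: HH_def proper_def poles_def C_minus_def)
qed

text \<open>Junk value where \<open>f\<close> has a pole; only meaningful on \<open>HH\<close> and \<open>C_plus\<close>.\<close>

fun ev :: "ratfun \<Rightarrow> ecomplex \<Rightarrow> complex" where
  "ev f (Fin s) = poly (cpoly (num f)) s / poly (cpoly (den f)) s"
| "ev f Infty = of_real (coeff (num f) (degree (den f)))"

declare ev.simps [simp del]

lemma C_plus_cases:
  assumes "p \<in> C_plus"
  obtains s where "p = Fin s" "Re s \<ge> 0" | "p = Infty"
proof (cases p)
  case (Fin s)
  then have "Re s \<ge> 0" using assms by (auto simp: C_plus_def C_minus_def)
  with Fin that(1) show thesis by blast
qed (use that in blast)

lemma Infty_in_C_plus [simp]: "Infty \<in> C_plus"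
  by (simp add: C_plus_def)

lemma Fin_in_C_plus_iff [simp]: "Fin s \<in> C_plus \<longleftrightarrow> Re s \<ge> 0"
  by (auto simp: C_plus_def C_minus_def)

lemma rf_eval_HH: "f \<in> HH \<Longrightarrow> p \<in> C_plus \<Longrightarrow> rf_eval f p = Fin (ev f p)"
  by (erule C_plus_cases) (auto simp: HH_D not_less ev.simps)

lemma ev_Fin:
  assumes "f = to_fract a / to_fract b" "poly (cpoly b) s \<noteq> 0"
  shows "ev f (Fin s) = poly (cpoly a) s / poly (cpoly b) s"
proof -
  have "b \<noteq> 0" using assms(2) by auto
  then obtain c where "c \<noteq> 0" "a = num f * c" "b = den f * c"
    using fract_cancel assms(1) by blast
  with assms(2) show ?thesis by (simp add: cpoly_mult ev.simps)
qed

text \<open>The cancelled factor contributes its leading coefficient to both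
  \<open>coeff a (degree b)\<close> and \<open>lead_coeff b\<close>, and \<open>den f\<close> is
  monic.\<close>

lemma ev_Infty:
  assumes "f = to_fract a / to_fract b" "b \<noteq> 0" "degree a \<le> degree b"
  shows "ev f Infty = of_real (coeff a (degree b) / lead_coeff b)"
proof -
  obtain c where c: "c \<noteq> 0" "a = num f * c" "b = den f * c"
    using fract_cancel assms by blast
  have deg: "degree (num f) \<le> degree (den f)"
    using assms(3) c by (cases "num f = 0") (auto simp: degree_mult_eq)
  have "coeff a (degree b) = coeff (num f) (degree (den f)) * lead_coeff c"
    using coeff_mult_top[OF deg order_refl, of c] c by (simp add: degree_mult_eq)
  moreover have "lead_coeff b = lead_coeff c"
    using c by (simp add: lead_coeff_mult)
  ultimately show ?thesis using c by (simp add: ev.simps)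
qed

section \<open>\<open>HH\<close> as a ring on which evaluation is a homomorphism\<close>

lemma
  assumes "f \<in> HH" "g \<in> HH"
  shows HH_add: "f + g \<in> HH"
    and ev_add: "p \<in> C_plus \<Longrightarrow> ev (f + g) p = ev f p + ev g p"
proof -
  define a b c d where "a = num f" "b = den f" "c = num g" "d = den g"
  have nz: "b \<noteq> 0" "d \<noteq> 0" and lc: "lead_coeff b = 1" "lead_coeff d = 1"
    by (auto simp: a_b_c_d_def)
  have eq: "f + g = to_fract (a * d + c * b) / to_fract (b * d)"
    using add_num_div_den by (simp only: a_b_c_d_def)
  have deg: "degree a \<le> degree b" "degree c \<le> degree d"
    using assms by (auto simp: a_b_c_d_def HH_D)
  have root: "poly (cpoly b) s \<noteq> 0" "poly (cpoly d) s \<noteq> 0" if "Re s \<ge> 0" for s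
    using assms that by (auto simp: a_b_c_d_def HH_D)
  have degbd: "degree (b * d) = degree b + degree d" using nz by (simp add: degree_mult_eq)
  have lcbd: "coeff (b * d) (degree b + degree d) = 1"
    using lc by (simp add: coeff_mult_degree_sum)
  have deg': "degree (a * d + c * b) \<le> degree (b * d)"
    unfolding degbd
    by (intro degree_add_le order_trans[OF degree_mult_le]) (use deg in auto)
  show "f + g \<in> HH"
    by (rule HH_I[OF eq]) (use nz deg' root in \<open>auto simp: cpoly_mult\<close>)
  assume "p \<in> C_plus"
  then show "ev (f + g) p = ev f p + ev g p"
  proof (cases rule: C_plus_cases)
    case (1 s)
    then show ?thesis
      using ev_Fin[OF eq, of s] root[of s]
      by (simp add: cpoly_mult cpoly_add add_frac_eq ev.simps[of f] ev.simps[of g]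
          a_b_c_d_def[symmetric])
  next
    case 2
    \<comment> \<open>The coefficients are taken at the degrees of the denominators, since the
      numerators \<open>a\<close> and \<open>c\<close> may have smaller degree.\<close>
    have "coeff (a * d) (degree b + degree d) = coeff a (degree b)"
      "coeff (c * b) (degree b + degree d) = coeff c (degree d)"
      using coeff_mult_top[of a "degree b" d "degree d"] coeff_mult_top[of c "degree d" b "degree b"]
        deg lc by (simp_all add: add.commute)
    then show ?thesis
      using ev_Infty[OF eq _ deg', unfolded degbd lcbd] 2 nz
      by (simp add: ev.simps[of f] ev.simps[of g] a_b_c_d_def[symmetric])
  qed
qed

lemma
  assumes "f \<in> HH" "g \<in> HH"
  shows HH_mult: "f * g \<in> HH"
    and ev_mult: "p \<in> C_plus \<Longrightarrow> ev (f * g) p = ev f p * ev g p"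
proof -
  define a b c d where "a = num f" "b = den f" "c = num g" "d = den g"
  have nz: "b \<noteq> 0" "d \<noteq> 0" and lc: "lead_coeff b = 1" "lead_coeff d = 1"
    by (auto simp: a_b_c_d_def)
  have eq: "f * g = to_fract (a * c) / to_fract (b * d)"
    using mult_num_div_den by (simp only: a_b_c_d_def)
  have deg: "degree a \<le> degree b" "degree c \<le> degree d"
    using assms by (auto simp: a_b_c_d_def HH_D)
  have root: "poly (cpoly b) s \<noteq> 0" "poly (cpoly d) s \<noteq> 0" if "Re s \<ge> 0" for s
    using assms that by (auto simp: a_b_c_d_def HH_D)
  have degbd: "degree (b * d) = degree b + degree d" using nz by (simp add: degree_mult_eq)
  have lcbd: "coeff (b * d) (degree b + degree d) = 1"
    using lc by (simp add: coeff_mult_degree_sum)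
  have deg': "degree (a * c) \<le> degree (b * d)"
    unfolding degbd by (rule order_trans[OF degree_mult_le]) (use deg in auto)
  show "f * g \<in> HH"
    by (rule HH_I[OF eq]) (use nz deg' root in \<open>auto simp: cpoly_mult\<close>)
  assume "p \<in> C_plus"
  then show "ev (f * g) p = ev f p * ev g p"
  proof (cases rule: C_plus_cases)
    case (1 s)
    then show ?thesis
      using ev_Fin[OF eq, of s] root[of s]
      by (simp add: cpoly_mult ev.simps[of f] ev.simps[of g] a_b_c_d_def[symmetric])
  next
    case 2
    then show ?thesis
      using ev_Infty[OF eq _ deg', unfolded degbd lcbd] 2 nz coeff_mult_top[OF deg]
      by (simp add: ev.simps[of f] ev.simps[of g] a_b_c_d_def[symmetric])
  qed
qed

lemma num_const_rf [simp]: "num (const_rf c) = [:c:]"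
  and den_const_rf [simp]: "den (const_rf c) = 1"
  by (simp_all add: num_def den_def const_rf_def)

lemma HH_const: "const_rf c \<in> HH"
  by (simp add: HH_def proper_def poles_def)

lemma ev_const: "ev (const_rf c) p = of_real c"
  by (cases p) (simp_all add: ev.simps map_poly_pCons)

lemma const_rf_1 [simp]: "const_rf 1 = 1"
  by (simp add: const_rf_def flip: one_pCons)

lemma const_rf_0 [simp]: "const_rf 0 = 0"
  by (simp add: const_rf_def)

lemma const_rf_diff: "const_rf (a - b) = const_rf a - const_rf b"
  by (simp add: const_rf_def flip: to_fract_diff)

lemma HH_diff:
  assumes "f \<in> HH" "g \<in> HH"
  shows "f - g \<in> HH"
proof -
  have "f + const_rf (- 1) * g \<in> HH"
    by (intro HH_add HH_mult HH_const assms)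
  moreover have "const_rf (- 1) = - 1"
    using const_rf_diff[of 0 1] by simp
  ultimately show ?thesis by simp
qed

section \<open>Units of \<open>HH\<close>\<close>

lemma JJ_iff: "u \<in> JJ \<longleftrightarrow> u \<in> HH \<and> (\<forall>p\<in>C_plus. ev u p \<noteq> 0)"
proof safe
  assume "u \<in> JJ"
  then obtain v where uv: "u \<in> HH" "v \<in> HH" "u * v = 1" by (auto simp: JJ_def)
  show "u \<in> HH" by fact
  fix p assume "p \<in> C_plus" "ev u p = 0"
  with uv ev_mult[of u v p] ev_const[of 1 p] show False by simp
next
  assume u: "u \<in> HH" and nz: "\<forall>p\<in>C_plus. ev u p \<noteq> 0"
  \<comment> \<open>A nonzero value at infinity forces the degree of \<open>num u\<close> up to that
    of \<open>den u\<close>, which makes the inverse proper.\<close>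
  have "coeff (num u) (degree (den u)) \<noteq> 0"
    using nz[rule_format, of Infty] by (simp add: ev.simps)
  then have "num u \<noteq> 0" and deg: "degree (den u) \<le> degree (num u)"
    by (auto intro: le_degree)
  have "inverse u = to_fract (den u) / to_fract (num u)"
    using num_div_den[of u] by (metis inverse_divide)
  then have "inverse u \<in> HH"
  proof (rule HH_I)
    fix s :: complex assume "Re s \<ge> 0"
    then have "ev u (Fin s) \<noteq> 0" using nz by simp
    then show "poly (cpoly (num u)) s \<noteq> 0" by (auto simp: ev.simps)
  qed (use \<open>num u \<noteq> 0\<close> deg in auto)
  moreover have "u * inverse u = 1" using \<open>num u \<noteq> 0\<close> by simp
  ultimately show "u \<in> JJ" using u by (auto simp: JJ_def)
qed

lemma JJ_inverse: "u \<in> JJ \<Longrightarrow> inverse u \<in> HH"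
  unfolding JJ_def by (auto dest: inverse_unique)

lemma JJ_nonzero: "u \<in> JJ \<Longrightarrow> u \<noteq> 0"
  by (auto simp: JJ_def)

lemma JJ_mult: "u \<in> JJ \<Longrightarrow> v \<in> JJ \<Longrightarrow> u * v \<in> JJ"
  by (auto simp: JJ_iff HH_mult ev_mult)

lemma JJ_HH: "u \<in> JJ \<Longrightarrow> u \<in> HH"
  by (simp add: JJ_def)

lemma HH_divide_unit: "f \<in> HH \<Longrightarrow> u \<in> JJ \<Longrightarrow> f / u \<in> HH"
  by (simp add: divide_inverse HH_mult JJ_inverse)

section \<open>Multiplicities of zeros and divisibility in \<open>HH\<close>\<close>

lemma zero_mult_mult:
  assumes "f \<in> HH" "g \<in> HH" "p \<in> C_plus"
  shows "zero_mult (f * g) p = zero_mult f p + zero_mult g p"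
proof (cases "f = 0 \<or> g = 0")
  case True
  then show ?thesis by (cases p) auto
next
  case False
  define h where "h = f * g"
  have eq: "h = to_fract (num f * num g) / to_fract (den f * den g)"
    using mult_num_div_den by (simp only: h_def)
  obtain c where c: "c \<noteq> 0" "num f * num g = num h * c" "den f * den g = den h * c"
    by (rule fract_cancel[OF eq]) (use that in auto)
  have h: "h \<in> HH" "h \<noteq> 0" using assms HH_mult False by (auto simp: h_def)
  from \<open>p \<in> C_plus\<close> have "zero_mult h p = zero_mult f p + zero_mult g p"
  proof (cases rule: C_plus_cases)
    case (1 s)
    \<comment> \<open>The cancelled factor \<open>c\<close> divides a denominator without roots in
      the closed right half-plane, so it does not affect the order at \<open>s\<close>.\<close>
    have "poly (cpoly (den f * den g)) s \<noteq> 0"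
      using assms HH_D(2) 1 by (simp add: cpoly_mult)
    then have "poly (cpoly c) s \<noteq> 0" unfolding c(3) by (simp add: cpoly_mult)
    moreover have "order s (cpoly (num f) * cpoly (num g)) = order s (cpoly (num h) * cpoly c)"
      using c(2) by (metis cpoly_mult)
    ultimately show ?thesis
      using False c(1) h by (simp add: order_mult order_0I 1)
  next
    case 2
    have "degree (num f) + degree (num g) = degree (num h) + degree c"
      using False c h by (metis degree_mult_eq num_eq_0_iff)
    moreover have "degree (den f) + degree (den g) = degree (den h) + degree c"
      using c by (metis degree_mult_eq den_nonzero)
    \<comment> \<open>Properness of \<open>f\<close>, \<open>g\<close> and \<open>h\<close> makes
      the truncated subtractions in \<open>zero_mult\<close> exact.\<close>
    ultimately show ?thesis
      using False h HH_D(1)[of f] HH_D(1)[of g] HH_D(1)[of h] assms by (simp add: 2)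
  qed
  then show ?thesis by (simp add: h_def)
qed

text \<open>The zeros of \<open>g\<close> in \<open>C_plus\<close> are cancelled by those of
  \<open>f\<close>, at infinity as well, so the quotient has no pole there. The hypothesis is
  restricted to zeros of \<open>g\<close> to match condition (i); elsewhere the inequality is
  trivial.\<close>

lemma HH_divide:
  assumes "f \<in> HH" "g \<in> HH" "g \<noteq> 0"
    and le: "\<And>p. p \<in> C_plus \<Longrightarrow> zero_mult g p > 0 \<Longrightarrow> zero_mult g p \<le> zero_mult f p"
  shows "f / g \<in> HH"
proof (cases "f = 0")
  case True
  then show ?thesis using HH_const[of 0] by simp
next
  case False
  have le: "zero_mult g p \<le> zero_mult f p" if "p \<in> C_plus" for p
    using le[OF that] by (cases "zero_mult g p = 0") auto
  define h where "h = f / g"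
  have "h \<noteq> 0" using False assms by (simp add: h_def)
  have eq: "h = to_fract (num f * den g) / to_fract (den f * num g)"
    using divide_num_div_den by (simp only: h_def)
  obtain c where c: "c \<noteq> 0" "num f * den g = num h * c" "den f * num g = den h * c"
    by (rule fract_cancel[OF eq]) (use \<open>g \<noteq> 0\<close> that in auto)
  have "poly (cpoly (den h)) s \<noteq> 0" if s: "Re s \<ge> 0" for s
  proof
    assume zero: "poly (cpoly (den h)) s = 0"
    then have nz: "poly (cpoly (num h)) s \<noteq> 0"
      using num_den_no_common_root by blast
    have "order s (cpoly (num f) * cpoly (den g)) = order s (cpoly (num h) * cpoly c)"
      "order s (cpoly (den f) * cpoly (num g)) = order s (cpoly (den h) * cpoly c)"
      using c by (metis cpoly_mult)+
    moreover have "order s (cpoly (den f)) = 0" "order s (cpoly (den g)) = 0"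
        "order s (cpoly (num h)) = 0"
      using assms s nz by (auto intro!: order_0I simp: HH_D)
    moreover have "order s (cpoly (den h)) \<noteq> 0"
      using zero by (simp add: order_root)
    \<comment> \<open>The order of \<open>num f\<close> is that of \<open>c\<close>, while the order
      of \<open>num g\<close> is that of \<open>c\<close> plus the positive order of
      \<open>den h\<close>.\<close>
    ultimately have "order s (cpoly (num f)) < order s (cpoly (num g))"
      using False c(1) \<open>h \<noteq> 0\<close> assms(3) by (simp add: order_mult)
    with le[of "Fin s"] s False assms(3) show False by simp
  qed
  moreover have "degree (num h) \<le> degree (den h)"
  proof -
    have "degree (num f) + degree (den g) = degree (num h) + degree c"
      using False c \<open>h \<noteq> 0\<close> by (metis degree_mult_eq den_nonzero num_eq_0_iff)
    moreover have "degree (den f) + degree (num g) = degree (den h) + degree c"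
      using assms(3) c by (metis degree_mult_eq den_nonzero num_eq_0_iff)
    ultimately show ?thesis
      using le[of Infty] False assms(3) HH_D(1)[OF assms(1)] HH_D(1)[OF assms(2)] by simp
  qed
  ultimately show ?thesis
    unfolding h_def[symmetric] using HH_I[OF num_div_den[of h]] by simp
qed

section \<open>Behaviour at infinity and compactness\<close>

lemma strictly_proper_HH_iff: "f \<in> HH \<Longrightarrow> strictly_proper f \<longleftrightarrow> ev f Infty = 0"
  by (simp add: strictly_proper_def rf_eval_HH HH_def del: rf_eval.simps)

lemma zero_mult_Infty_eq_0: "ev f Infty \<noteq> 0 \<Longrightarrow> zero_mult f Infty = 0"
  by (auto simp: zero_enat_def ev.simps dest: le_degree)

text \<open>Compare leading terms: for equal degrees divide both polynomials by that power of
  \<open>s\<close>; for a numerator of smaller degree both the limit and the coefficient are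
  0.\<close>

lemma ev_tendsto_Infty:
  assumes "f \<in> HH"
  shows "((\<lambda>s. ev f (Fin s)) \<longlongrightarrow> ev f Infty) at_infinity"
proof -
  define a b where "a = cpoly (num f)" "b = cpoly (den f)"
  have lc: "lead_coeff b = 1" using lead_coeff_den[of f] 
    by (simp add: a_b_def coeff_map_poly del: lead_coeff_den)
  have deg: "degree a \<le> degree b"
    using HH_D(1)[OF assms] by (simp add: a_b_def)
  have nz: "\<forall>\<^sub>F s in at_infinity. (s::complex) \<noteq> 0"
    by (rule eventually_at_infinityI[of 1]) auto
  have "((\<lambda>s. poly a s / poly b s) \<longlongrightarrow> coeff a (degree b)) at_infinity"
  proof (cases "degree a = degree b")
    case True
    have "((\<lambda>s. (poly a s / s ^ degree a) / (poly b s / s ^ degree b))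
            \<longlongrightarrow> lead_coeff a / lead_coeff b) at_infinity"
      by (intro tendsto_divide poly_divide_tendsto_aux) (simp add: lc)
    moreover have "\<forall>\<^sub>F s in at_infinity.
        (poly a s / s ^ degree a) / (poly b s / s ^ degree b) = poly a s / poly b s"
      using nz by eventually_elim (simp add: True)
    ultimately have "((\<lambda>s. poly a s / poly b s) \<longlongrightarrow> lead_coeff a / lead_coeff b) at_infinity"
      by (rule Lim_transform_eventually)
    then show ?thesis by (simp add: lc True)
  next
    case False
    with deg have "degree a < degree b" by simp
    then show ?thesis
      using poly_divide_tendsto_0_at_infinity[of a b] by (simp add: coeff_eq_0)
  qed
  then show ?thesis by (simp add: a_b_def coeff_map_poly ev.simps)
qed

text \<open>The closed half-plane is not compact, so the values far out are replaced by a small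
  closed ball around the value at infinity.\<close>

lemma ev_compact_range:
  assumes f: "f \<in> HH" and "closed S" and avoid: "\<And>p. p \<in> C_plus \<Longrightarrow> ev f p \<notin> S"
  obtains K where "compact K" "K \<inter> S = {}" "\<And>p. p \<in> C_plus \<Longrightarrow> ev f p \<in> K"
proof -
  have "open (- S)" "ev f Infty \<in> - S" using assms(2) avoid[of Infty] by auto
  then obtain e where e: "e > 0" "cball (ev f Infty) e \<subseteq> - S"
    using open_contains_cball by blast
  have "\<forall>\<^sub>F s in at_infinity. dist (ev f (Fin s)) (ev f Infty) < e"
    using ev_tendsto_Infty[OF f] e(1) by (rule tendstoD)
  then obtain R where R: "\<And>s. norm s \<ge> R \<Longrightarrow> dist (ev f (Fin s)) (ev f Infty) < e"
    by (auto simp: eventually_at_infinity)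
  define B where "B = {s. Re s \<ge> 0} \<inter> cball 0 R"
  define K where "K = (\<lambda>s. ev f (Fin s)) ` B \<union> cball (ev f Infty) e"
  have "compact B"
    unfolding B_def by (intro closed_Int_compact closed_halfspace_Re_ge compact_cball)
  moreover have "continuous_on B (\<lambda>s. ev f (Fin s))"
    by (auto simp: B_def HH_D[OF f] ev.simps intro!: continuous_intros)
  ultimately have "compact K"
    unfolding K_def by (intro compact_Un compact_continuous_image compact_cball)
  moreover have "K \<inter> S = {}"
    using e(2) avoid by (auto simp: K_def B_def)
  moreover have "ev f p \<in> K" if "p \<in> C_plus" for p
    using that
  proof (cases rule: C_plus_cases)
    case (1 s)
    then show ?thesis using R[of s] 
      by (cases "norm s \<ge> R") (auto simp: K_def B_def dist_commute)
  next
    case 2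
    then show ?thesis using e(1) by (simp add: K_def)
  qed
  ultimately show thesis by (rule that)
qed

text \<open>With the empty set to avoid, \<open>ev_compact_range\<close> still encloses all values
  in a compact set.\<close>

lemma HH_bounded:
  assumes "f \<in> HH"
  obtains M where "M > 0" "\<And>p. p \<in> C_plus \<Longrightarrow> norm (ev f p) \<le> M"
proof -
  obtain K where "compact K" "\<And>p. p \<in> C_plus \<Longrightarrow> ev f p \<in> K"
    using ev_compact_range[OF assms closed_empty] by auto
  then show thesis
    using that by (metis bounded_pos compact_imp_bounded)
qed

text \<open>If \<open>(1 - l) + l * z\<close> vanishes, then \<open>z = (l - 1) / l\<close>, a
  nonpositive real. Off these values the norm is positive, and it attains its minimum on the compact
  set of pairs \<open>(l, z)\<close>.\<close>

lemma convex_comb_1_bounded_below: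
  assumes f: "f \<in> HH" and avoid: "\<And>p. p \<in> C_plus \<Longrightarrow> ev f p \<notin> \<real>\<^sub>\<le>\<^sub>0"
  obtains m where "m > 0"
    "\<And>p l. p \<in> C_plus \<Longrightarrow> l \<in> {0..1} \<Longrightarrow> m \<le> norm (of_real (1 - l) + of_real l * ev f p)"
proof -
  obtain K where K: "compact K" "K \<inter> \<real>\<^sub>\<le>\<^sub>0 = {}" "\<And>p. p \<in> C_plus \<Longrightarrow> ev f p \<in> K"
    using ev_compact_range[OF f closed_nonpos_Reals_complex avoid] by blast
  define h where "h = (\<lambda>(l::real, z::complex). norm (of_real (1 - l) + of_real l * z))"
  have "continuous_on ({0..1} \<times> K) h"
    by (auto simp: h_def case_prod_unfold intro!: continuous_intros)
  moreover have "compact ({0..1::real} \<times> K)" using K(1) by (intro compact_Times) auto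
  moreover have "{0..1::real} \<times> K \<noteq> {}" using K(3)[of Infty] by auto
  ultimately obtain q where q: "q \<in> {0..1} \<times> K" "\<And>r. r \<in> {0..1} \<times> K \<Longrightarrow> h q \<le> h r"
    using continuous_attains_inf by metis
  obtain l z where lz: "q = (l, z)" "0 \<le> l" "l \<le> 1" "z \<in> K" using q(1) by auto
  have "h q \<noteq> 0"
  proof
    assume "h q = 0"
    then have eq: "of_real l * z = of_real (l - 1)"
      by (simp add: h_def lz algebra_simps add_eq_0_iff)
    then have "l \<noteq> 0" by auto
    with eq have "z = of_real ((l - 1) / l)" by (simp add: field_simps)
    moreover have "(l - 1) / l \<le> 0" using lz by (simp add: divide_nonpos_nonneg)
    ultimately have "z \<in> \<real>\<^sub>\<le>\<^sub>0" by (auto simp: complex_nonpos_Reals_iff)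
    with K(2) lz(4) show False by auto
  qed
  moreover have "h q \<ge> 0" by (simp add: h_def lz)
  ultimately have "h q > 0" by simp
  then show thesis
    using q(2) K(3) by (intro that[of "h q"]) (force simp: h_def)+
qed

section \<open>Coprimeness and the choice of factorization of the compensator\<close>

lemma coprime_HH_if_unit_combination:
  assumes "x \<in> HH" "y \<in> HH" "x * a + y * b \<in> JJ"
  shows "coprime_HH a b"
  unfolding coprime_HH_def
proof (intro ballI impI)
  fix d assume d: "d \<in> HH" and "dvd_HH d a \<and> dvd_HH d b"
  then obtain q r where q: "q \<in> HH" "a = d * q" and r: "r \<in> HH" "b = d * r"
    by (auto simp: dvd_HH_def)
  obtain v where v: "v \<in> HH" "(x * a + y * b) * v = 1"
    using assms(3) by (auto simp: JJ_def)
  \<comment> \<open>A common divisor \<open>d\<close> factors out of the unit combination and so is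
    itself invertible.\<close>
  then have "d * ((x * q + y * r) * v) = 1"
    by (simp add: q r algebra_simps)
  moreover have "(x * q + y * r) * v \<in> HH"
    by (intro HH_mult HH_add assms q r v)
  ultimately show "d \<in> JJ" using d by (auto simp: JJ_def)
qed

lemma coprime_factorization_denom:
  assumes "coprime_factorization k x y"
  shows "ev y Infty \<noteq> 0" "y \<noteq> 0"
proof -
  show nz: "ev y Infty \<noteq> 0"
    using assms by (auto simp: coprime_factorization_def strictly_proper_HH_iff)
  show "y \<noteq> 0"
    using nz by (auto simp: ev.simps)
qed

text \<open>If \<open>x * a' + y * b'\<close> is a unit, then the factor relating the two factorizations of \<open>k\<close>
  lies in \<open>HH\<close> and divides both \<open>a\<close> and \<open>b\<close>, so it is a unit by coprimality.\<close>

lemma stabilizes_any_factorization: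
  assumes k: "coprime_factorization k a b" and "stabilizes k x y" "x \<in> HH" "y \<in> HH"
  shows "x * a + y * b \<in> JJ"
proof -
  obtain a' b' where k': "coprime_factorization k a' b'" and u: "x * a' + y * b' \<in> JJ"
    using assms(2) by (auto simp: stabilizes_def)
  have HH: "a \<in> HH" "b \<in> HH" "a' \<in> HH" "b' \<in> HH"
    using k k' by (auto simp: coprime_factorization_def)
  have nz: "b \<noteq> 0" "b' \<noteq> 0"
    using coprime_factorization_denom k k' by blast+
  have "a / b = a' / b'"
    using k k' by (simp add: coprime_factorization_def)
  define f where "f = b / b'"
  have b: "b = f * b'" and a: "a = f * a'"
    using nz \<open>a / b = a' / b'\<close> by (simp_all add: f_def field_simps)
  have eq: "x * a + y * b = f * (x * a' + y * b')"
    by (simp add: a b algebra_simps)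
  then have "f = (x * a + y * b) / (x * a' + y * b')"
    using JJ_nonzero[OF u] by simp
  then have "f \<in> HH"
    using HH_divide_unit[OF _ u] HH assms by (simp add: HH_add HH_mult)
  then have "f \<in> JJ"
    using k a b HH by (auto simp: coprime_factorization_def coprime_HH_def dvd_HH_def)
  with u show ?thesis by (simp add: eq JJ_mult)
qed

section \<open>Units along the segment from \<open>d0\<close> to \<open>d1\<close>\<close>

lemma ratio_avoids_nonpos_Reals:
  assumes "d0 \<in> JJ" "d1 \<in> JJ" "p \<in> C_plus"
    and units: "\<And>l. l \<in> {0..1} \<Longrightarrow> const_rf (1 - l) * d0 + const_rf l * d1 \<in> JJ"
  shows "ev (d1 / d0) p \<notin> \<real>\<^sub>\<le>\<^sub>0"
proof
  assume "ev (d1 / d0) p \<in> \<real>\<^sub>\<le>\<^sub>0"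
  then obtain r where r: "r \<ge> 0" "ev (d1 / d0) p = - of_real r"
    by (metis nonpos_Reals_cases neg_0_le_iff_le of_real_minus minus_minus)
  have HH: "d0 \<in> HH" "d1 / d0 \<in> HH" "d1 \<in> HH" using assms by (auto simp: JJ_HH HH_divide_unit)
  have "d1 = d0 * (d1 / d0)" using JJ_nonzero[OF assms(1)] by simp
  then have ev1: "ev d1 p = - ev d0 p * of_real r"
    using ev_mult[OF HH(1,2) assms(3)] r(2) by simp
  \<comment> \<open>This parameter solves \<open>(1 - l) - l * r = 0\<close>, so the combination
    vanishes at \<open>p\<close> when \<open>d1 / d0\<close> has the value \<open>- r\<close>
    there.\<close>
  define l where "l = 1 / (1 + r)"
  have l: "l \<in> {0..1}" "l * r = 1 - l" using r(1) by (auto simp: l_def field_simps)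
  have "ev (const_rf (1 - l) * d0 + const_rf l * d1) p
      = ev d0 p * (of_real (1 - l) - of_real (l * r))"
    using HH assms(3) by (simp add: ev_add ev_mult HH_mult HH_const ev_const ev1 algebra_simps)
  also have "\<dots> = 0" by (simp add: l(2))
  finally show False using units[OF l(1)] assms(3) by (simp add: JJ_iff)
qed

text \<open>Adding the constant \<open>t\<close> to \<open>yc\<close> shifts \<open>d0\<close> and
  \<open>d1\<close> by \<open>t\<close> times \<open>y0\<close> and \<open>y1\<close>. Once
  \<open>d0\<close> is factored out, the values have the form \<open>A + t * B\<close> with
  \<open>A\<close> bounded away from 0 and \<open>B\<close> bounded, uniformly in \<open>l\<close>
  and the point of \<open>C_plus\<close>, so one \<open>e\<close> serves all of them.\<close>

lemma perturbed_convex_comb_unit: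
  assumes d: "d0 \<in> JJ" "d1 \<in> JJ" and y: "y0 \<in> HH" "y1 \<in> HH"
    and avoid: "\<And>p. p \<in> C_plus \<Longrightarrow> ev (d1 / d0) p \<notin> \<real>\<^sub>\<le>\<^sub>0"
  obtains e where "e > 0"
    "\<And>t l. t \<in> {0..e} \<Longrightarrow> l \<in> {0..1} \<Longrightarrow>
       const_rf (1 - l) * (d0 + const_rf t * y0) + const_rf l * (d1 + const_rf t * y1) \<in> JJ"
proof -
  define r z0 z1 where "r = d1 / d0" "z0 = y0 / d0" "z1 = y1 / d0"
  have HH: "d0 \<in> HH" "d1 \<in> HH" "r \<in> HH" "z0 \<in> HH" "z1 \<in> HH"
    using d y by (auto simp: r_z0_z1_def JJ_HH HH_divide_unit)
  have "d0 \<noteq> 0" using d JJ_nonzero by blast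
  obtain m where m: "m > 0"
    "\<And>p l. p \<in> C_plus \<Longrightarrow> l \<in> {0..1} \<Longrightarrow> m \<le> norm (of_real (1 - l) + of_real l * ev r p)"
    using convex_comb_1_bounded_below[OF HH(3)] avoid unfolding r_z0_z1_def by blast
  obtain M0 where M0: "M0 > 0" "\<And>p. p \<in> C_plus \<Longrightarrow> norm (ev z0 p) \<le> M0"
    using HH_bounded[OF HH(4)] by blast
  obtain M1 where M1: "M1 > 0" "\<And>p. p \<in> C_plus \<Longrightarrow> norm (ev z1 p) \<le> M1"
    using HH_bounded[OF HH(5)] by blast
  \<comment> \<open>Chosen so that the perturbation has norm at most \<open>m / 2\<close>, below the
    lower bound \<open>m\<close> for \<open>A\<close>.\<close>
  define e where "e = m / (2 * (M0 + M1))"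
  have "e > 0" using m(1) M0(1) M1(1) by (simp add: e_def)
  moreover have "const_rf (1 - l) * (d0 + const_rf t * y0) + const_rf l * (d1 + const_rf t * y1) \<in> JJ"
    (is "?u \<in> JJ") if t: "t \<in> {0..e}" and l: "l \<in> {0..1}" for t l
    unfolding JJ_iff
  proof (intro conjI ballI)
    show "?u \<in> HH" by (intro HH_add HH_mult HH_const HH y)
    fix p assume p: "p \<in> C_plus"
    define A B where "A = of_real (1 - l) + of_real l * ev r p"
      and "B = of_real (1 - l) * ev z0 p + of_real l * ev z1 p"
    have "?u = d0 * ((const_rf (1 - l) + const_rf l * r)
                + const_rf t * (const_rf (1 - l) * z0 + const_rf l * z1))"
      using \<open>d0 \<noteq> 0\<close> by (simp add: r_z0_z1_def field_simps)
    then have eq: "ev ?u p = ev d0 p * (A + of_real t * B)"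
      using HH p by (simp add: ev_add ev_mult HH_add HH_mult HH_const ev_const A_def B_def)
    have "norm B \<le> M0 + M1"
    proof -
      have "norm B \<le> (1 - l) * norm (ev z0 p) + l * norm (ev z1 p)"
        unfolding B_def using l by (intro norm_triangle_le) (simp add: norm_mult del: of_real_diff)
      also have "\<dots> \<le> 1 * M0 + 1 * M1"
        using l M0 M1 p by (intro add_mono mult_mono) auto
      finally show ?thesis by simp
    qed
    then have "norm (of_real t * B) \<le> e * (M0 + M1)"
      using t M0(1) M1(1) by (auto simp: norm_mult intro!: mult_mono)
    moreover have "e * (M0 + M1) = m / 2"
      using M0(1) M1(1) by (simp add: e_def field_simps)
    moreover have "m \<le> norm A"
      unfolding A_def by (rule m(2)[OF p l])
    ultimately have "norm (of_real t * B) < norm A"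
      using m(1) by linarith
    then have "A + of_real t * B \<noteq> 0"
      by (metis add_eq_0_iff norm_minus_cancel less_irrefl)
    moreover have "ev d0 p \<noteq> 0" using d p by (simp add: JJ_iff)
    ultimately show "ev ?u p \<noteq> 0" using eq by simp
  qed
  ultimately show thesis by (rule that)
qed

text \<open>The quotient of two units lies in \<open>HH\<close>, so its values on
  \<open>C_plus\<close> are finite and given by \<open>ev\<close>.\<close>

lemma rf_eval_ratio_iff:
  assumes "d0 \<in> JJ" "d1 \<in> JJ" "p \<in> C_plus"
  shows "rf_eval (d1 / d0) p \<notin> Fin ` \<real>\<^sub>\<le>\<^sub>0 \<union> {Infty} \<longleftrightarrow> ev (d1 / d0) p \<notin> \<real>\<^sub>\<le>\<^sub>0"
  using assms by (auto simp: rf_eval_HH HH_divide_unit JJ_HH simp del: rf_eval.simps)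

theorem proposition2:
  fixes p0 p1 x0 y0 x1 y1 :: ratfun
  assumes "coprime_factorization p0 x0 y0"
    and "coprime_factorization p1 x1 y1"
    and "p0 \<noteq> p1"
  shows
    "(\<exists>k. proper_compensator k \<and>
        (\<forall>l\<in>{0..1::real}.
           stabilizes k (const_rf l * x1 + const_rf (1 - l) * x0)
                        (const_rf l * y1 + const_rf (1 - l) * y0)))
     \<longleftrightarrow>
     (\<exists>d0\<in>JJ. \<exists>d1\<in>JJ.
        (\<forall>s\<in>C_plus. zero_mult (x0 * y1 - x1 * y0) s > 0 \<longrightarrow>
            zero_mult (d0 * y1 - d1 * y0) s \<ge> zero_mult (x0 * y1 - x1 * y0) s \<and>
            zero_mult (d1 * x0 - d0 * x1) s \<ge> zero_mult (x0 * y1 - x1 * y0) s) \<and>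
        (zero_mult (x0 * y1 - x1 * y0) Infty > 0 \<longrightarrow>
            zero_mult (d1 * x0 - d0 * x1) Infty = zero_mult (x0 * y1 - x1 * y0) Infty) \<and>
        (\<forall>s\<in>C_plus. rf_eval (d1 / d0) s \<notin> Fin ` \<real>\<^sub>\<le>\<^sub>0 \<union> {Infty}))"
    (is "?stab \<longleftrightarrow> ?interp")
proof -
  define \<Delta> where "\<Delta> = x0 * y1 - x1 * y0"
  have HH: "x0 \<in> HH" "y0 \<in> HH" "x1 \<in> HH" "y1 \<in> HH"
    and p: "p0 = x0 / y0" "p1 = x1 / y1"
    using assms by (auto simp: coprime_factorization_def)
  have \<Delta>_HH: "\<Delta> \<in> HH" unfolding \<Delta>_def by (intro HH_diff HH_mult HH)
  \<comment> \<open>Since \<open>y0\<close> and \<open>y1\<close> are nonzero, equality of the cross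
    products would make the two plants equal.\<close>
  have "\<Delta> \<noteq> 0"
    using assms(3) coprime_factorization_denom(2)[OF assms(1)] coprime_factorization_denom(2)[OF assms(2)]
    by (simp add: \<Delta>_def p frac_eq_eq)
  show ?thesis
  proof
    assume ?stab
    then obtain k xc yc where k: "coprime_factorization k xc yc"
      and stab: "\<And>l. l \<in> {0..1::real} \<Longrightarrow>
        stabilizes k (const_rf l * x1 + const_rf (1 - l) * x0)
                     (const_rf l * y1 + const_rf (1 - l) * y0)"
      by (auto simp: proper_compensator_def)
    have c_HH: "xc \<in> HH" "yc \<in> HH" using k by (auto simp: coprime_factorization_def)
    define d0 d1 where "d0 = x0 * xc + y0 * yc" "d1 = x1 * xc + y1 * yc"
    have unit: "const_rf (1 - l) * d0 + const_rf l * d1 \<in> JJ" if "l \<in> {0..1}" for l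
    proof -
      \<comment> \<open>The factorization witnessing \<open>stabilizes\<close> may depend on
        \<open>l\<close>; here it is replaced by the fixed pair \<open>xc\<close>,
        \<open>yc\<close>.\<close>
      have "(const_rf l * x1 + const_rf (1 - l) * x0) * xc
          + (const_rf l * y1 + const_rf (1 - l) * y0) * yc \<in> JJ"
        by (intro stabilizes_any_factorization[OF k stab[OF that]] HH_add HH_mult HH_const HH)
      then show ?thesis by (simp add: d0_d1_def algebra_simps)
    qed
    have d: "d0 \<in> JJ" "d1 \<in> JJ" using unit[of 0] unit[of 1] by simp_all
    have eqs: "d0 * y1 - d1 * y0 = xc * \<Delta>" "d1 * x0 - d0 * x1 = yc * \<Delta>"
      by (simp_all add: d0_d1_def \<Delta>_def algebra_simps)
    \<comment> \<open>Condition (ii) expresses that \<open>yc\<close> is not strictly proper: it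
      adds nothing to the multiplicity of \<open>\<Delta>\<close> at infinity.\<close>
    have "zero_mult yc Infty = 0"
      by (intro zero_mult_Infty_eq_0 coprime_factorization_denom[OF k])
    then have "zero_mult (yc * \<Delta>) Infty = zero_mult \<Delta> Infty"
      by (simp add: zero_mult_mult c_HH \<Delta>_HH del: zero_mult.simps)
    moreover have "\<forall>s\<in>C_plus. rf_eval (d1 / d0) s \<notin> Fin ` \<real>\<^sub>\<le>\<^sub>0 \<union> {Infty}"
      using ratio_avoids_nonpos_Reals[OF d _ unit] rf_eval_ratio_iff[OF d] by blast
    moreover have "\<forall>s\<in>C_plus. zero_mult (xc * \<Delta>) s \<ge> zero_mult \<Delta> s \<and> zero_mult (yc * \<Delta>) s \<ge> zero_mult \<Delta> s"
      by (simp add: zero_mult_mult c_HH \<Delta>_HH del: zero_mult.simps)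
    ultimately show ?interp
      unfolding \<Delta>_def[symmetric] using d eqs by (intro bexI[of _ d0] bexI[of _ d1]) auto
  next
    assume ?interp
    then obtain d0 d1 where d: "d0 \<in> JJ" "d1 \<in> JJ"
      and mult: "\<And>s. s \<in> C_plus \<Longrightarrow> zero_mult \<Delta> s > 0 \<Longrightarrow>
          zero_mult \<Delta> s \<le> zero_mult (d0 * y1 - d1 * y0) s \<and>
          zero_mult \<Delta> s \<le> zero_mult (d1 * x0 - d0 * x1) s"
      and "\<And>s. s \<in> C_plus \<Longrightarrow> rf_eval (d1 / d0) s \<notin> Fin ` \<real>\<^sub>\<le>\<^sub>0 \<union> {Infty}"
      unfolding \<Delta>_def[symmetric] by blast
    then have avoid: "ev (d1 / d0) s \<notin> \<real>\<^sub>\<le>\<^sub>0" if "s \<in> C_plus" for s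
      using rf_eval_ratio_iff[OF d that] that by blast
    have d_HH: "d0 \<in> HH" "d1 \<in> HH" using d JJ_HH by auto
    define xc yc where "xc = (d0 * y1 - d1 * y0) / \<Delta>" "yc = (d1 * x0 - d0 * x1) / \<Delta>"
    have c_HH: "xc \<in> HH" "yc \<in> HH"
      unfolding xc_yc_def using mult
      by (auto intro!: HH_divide HH_diff HH_mult d_HH HH \<Delta>_HH \<open>\<Delta> \<noteq> 0\<close> simp del: zero_mult.simps)
    have d_eq: "x0 * xc + y0 * yc = d0" "x1 * xc + y1 * yc = d1"
      using \<open>\<Delta> \<noteq> 0\<close> by (simp_all add: xc_yc_def divide_simps) (simp_all add: \<Delta>_def algebra_simps)
    obtain e where e: "e > 0"
      "\<And>t l. t \<in> {0..e} \<Longrightarrow> l \<in> {0..1} \<Longrightarrow>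
         const_rf (1 - l) * (d0 + const_rf t * y0) + const_rf l * (d1 + const_rf t * y1) \<in> JJ"
      using perturbed_convex_comb_unit[OF d HH(2,4) avoid] by blast
    \<comment> \<open>If \<open>\<Delta>\<close> does not vanish at infinity, then \<open>yc\<close> may be strictly proper; adding a small
      constant repairs this without leaving the open set of stabilizing compensators.\<close>
    obtain t where t: "t \<in> {0..e}" "ev yc Infty + of_real t \<noteq> 0"
    proof (cases "ev yc Infty = 0")
      case True
      then show thesis using that[of e] e(1) by simp
    next
      case False
      then show thesis using that[of 0] e(1) by simp
    qed
    define yc' where "yc' = yc + const_rf t"
    have "yc' \<in> HH" unfolding yc'_def by (intro HH_add HH_const c_HH)
    have "ev yc' Infty \<noteq> 0"
      using t(2) by (simp add: yc'_def ev_add c_HH HH_const ev_const)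
    \<comment> \<open>Replacing \<open>yc\<close> by \<open>yc'\<close> turns \<open>d0\<close> and
      \<open>d1\<close> into the perturbed pair handled by the choice of \<open>e\<close>.\<close>
    have unit: "(const_rf l * x1 + const_rf (1 - l) * x0) * xc
        + (const_rf l * y1 + const_rf (1 - l) * y0) * yc' \<in> JJ" if "l \<in> {0..1}" for l
      using e(2)[OF t(1) that] unfolding yc'_def d_eq[symmetric] by (simp add: algebra_simps)
    \<comment> \<open>The case \<open>l = 0\<close> is a unit combination of \<open>xc\<close> and
      \<open>yc'\<close> with coefficients \<open>x0\<close> and \<open>y0\<close>.\<close>
    have "coprime_HH xc yc'"
      using unit[of 0] coprime_HH_if_unit_combination[OF HH(1,2)] by simp
    then have "coprime_factorization (xc / yc') xc yc'"
      using c_HH \<open>yc' \<in> HH\<close> \<open>ev yc' Infty \<noteq> 0\<close>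
      by (simp add: coprime_factorization_def strictly_proper_HH_iff)
    then show ?stab
      using unit unfolding proper_compensator_def stabilizes_def by blast
  qed
qed

end
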